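(* Let $p>0$ be such that $\frac{2}{p}$ is a natural number (positive integer) other than $2$. For $\eta=(\eta_1,\eta_2)\in\mathbb{R}^2$ write $$\eta_{1}=\mathrm{sgn}(\cos\varphi)\,|\eta|_{p}\,|\cos\varphi|^{\frac{2}{p}},\qquad \eta_{2}=\mathrm{sgn}(\sin\varphi)\,|\eta|_{p}\,|\sin\varphi|^{\frac{2}{p}}\qquad(0\leq\varphi<2\pi).$$ Then, uniformly with respect to $\varphi\in[0,2\pi)$, $$J_{0}^{[p]}(\eta)=\begin{cases}\mathcal{O}(|\eta|_{p}^{-\frac{1}{2}}) & \text{if } p=2,\\ \mathcal{O}(|\eta|_{p}^{-\frac{p}{2}}) & \text{if } \frac{2}{p}\in\mathbb{N}\setminus\{1,2\},\end{cases}\qquad\text{as }|\eta|_{p}\to\infty.$$ That is, there are constants $C,R>0$ (depending only on $p$) such that for all $\eta\in\mathbb{R}^2$ with $|\eta|_p\ge R$ one has $|J_0^{[p]}(\eta)|\le C|\eta|_p^{-1/2}$ if $p=2$, and $|J_0^{[p]}(\eta)|\le C|\eta|_p^{-p/2}$ if $\frac2p\in\mathbb{N}\setminus\{1,2\}$.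
   Context: For $p>0$ and $\eta\in\mathbb{R}^2$, $|\eta|_p:=(|\eta_1|^p+|\eta_2|^p)^{1/p}$. The generalized Bessel function of order zero is, for $\eta\in\mathbb{R}^2$, $$J_{0}^{[p]}(\eta):=\frac{1}{\Gamma^{2}(\frac{1}{p})}\left(\frac{2}{p}\right)^{2}\int_{0}^{1}\cos(\eta_{1}t^{\frac{1}{p}})\cos(\eta_{2}(1-t)^{\frac{1}{p}})\,t^{\frac{1}{p}-1}(1-t)^{\frac{1}{p}-1}\,dt,$$ where $\Gamma$ is the gamma function. $\mathrm{sgn}$ is the sign function with $\mathrm{sgn}(0)=0$. $\mathbb{N}=\{1,2,3,\dots\}$. *)

theory Defs
  imports "HOL-Analysis.Analysis"
begin

definition pnorm :: "real \<Rightarrow> real ^ 2 \<Rightarrow> real" where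
  "pnorm p \<eta> = (\<bar>\<eta> $ 1\<bar> powr p + \<bar>\<eta> $ 2\<bar> powr p) powr (1 / p)"

text \<open>For \<open>p > 0\<close> the integrand is dominated by a Beta integrand, hence it is absolutely
  integrable and the gauge integral below agrees with the Lebesgue one. At the endpoints, where the
  integrand may be singular, \<open>0 powr a = 0\<close> only changes it on a null set.\<close>

definition gen_bessel0 :: "real \<Rightarrow> real ^ 2 \<Rightarrow> real" where
  "gen_bessel0 p \<eta> =
     1 / (Gamma (1 / p))\<^sup>2 * (2 / p)\<^sup>2 *
     integral {0..1} (\<lambda>t. cos (\<eta> $ 1 * t powr (1 / p)) * cos (\<eta> $ 2 * (1 - t) powr (1 / p)) *
                          t powr (1 / p - 1) * (1 - t) powr (1 / p - 1))"

definition ppolar :: "real \<Rightarrow> real \<Rightarrow> real \<Rightarrow> real ^ 2" where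
  "ppolar p r \<phi> = vector
     [sgn (cos \<phi>) * r * \<bar>cos \<phi>\<bar> powr (2 / p),
      sgn (sin \<phi>) * r * \<bar>sin \<phi>\<bar> powr (2 / p)]"

end

theory Submission
  imports Defs
begin

text \<open>
  Let \<open>q = 1 / p\<close>, \<open>L = max \<bar>\<eta>\<^sub>1\<bar> \<bar>\<eta>\<^sub>2\<bar>\<close> and \<open>A t = (t (1 - t)) powr (q - 1)\<close>. Splitting the product
  of cosines gives two integrals of \<open>A cos \<psi>\<close> with \<open>\<psi>' = q A D\<close>, where
  \<open>D t = a (1 - t) powr (1 - q) \<mp> b t powr (1 - q)\<close> is monotone on at most two pieces. Instead of
  cutting out the stationary points one subtracts the derivative of \<open>sin \<psi> D / (q (D\<^sup>2 + L))\<close>: the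
  remainder is dominated by \<open>A L / (D\<^sup>2 + L)\<close> and by \<open>\<bar>D'\<bar> / (D\<^sup>2 + L)\<close>, a derivative of an arctangent.
  Wherever \<open>\<bar>D\<bar> < L / 2\<close> one has \<open>A \<le> K \<bar>D'\<bar> / L\<close> (for \<open>q = 1 / 2\<close> because \<open>D\<^sup>2 + (2 D' / A)\<^sup>2 = a\<^sup>2 + b\<^sup>2\<close>,
  for \<open>q > 1\<close> because \<open>A \<le> 1\<close> and \<open>\<bar>D'\<bar> \<ge> (q - 1) L\<close> for the upper sign, while \<open>D \<ge> L\<close> for the
  lower one), so both terms integrate to \<open>O(1 / sqrt L)\<close>. This decay
  is at least as good as the claimed one, since \<open>p / 2 < 1 / 2\<close> when \<open>2 / p \<ge> 3\<close>.
\<close>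

section \<open>Oscillatory integrals with a monotone factor in the phase derivative\<close>

text \<open>Integration by parts against 1 / \<open>D\<close> breaks down at a stationary point; the
  regularised quotient \<open>D / (D\<^sup>2 + L)\<close> does not. Since \<open>D\<close> is
  monotone, the error is majorised by the derivative of an arctangent, whose increment is at most
  \<open>pi\<close> on every interval. In the constant, 1 / \<open>q\<close> comes from the boundary
  terms, \<open>pi / q\<close> and \<open>pi * K\<close> from the arctangent, and
  \<open>4 * M\<close> from the region where \<open>D\<close> is large.\<close>

lemma oscillatory_integral_bound_mono:
  fixes A D D' \<psi> :: "real \<Rightarrow> real"
  assumes "\<alpha> \<le> \<beta>" "q > 0" "L \<ge> 1" "K \<ge> 0"
    and \<psi>: "\<And>t. t \<in> {\<alpha>..\<beta>} \<Longrightarrow> (\<psi> has_real_derivative q * A t * D t) (at t)"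
    and D: "\<And>t. t \<in> {\<alpha>..\<beta>} \<Longrightarrow> (D has_real_derivative D' t) (at t)"
    and D': "\<And>t. t \<in> {\<alpha>..\<beta>} \<Longrightarrow> 0 \<le> D' t"
    and A: "continuous_on {\<alpha>..\<beta>} A" "\<And>t. t \<in> {\<alpha>..\<beta>} \<Longrightarrow> 0 \<le> A t"
    and M: "integral {\<alpha>..\<beta>} A \<le> M"
    and alt: "\<And>t. t \<in> {\<alpha>..\<beta>} \<Longrightarrow> A t \<le> K / L * D' t \<or> \<bar>D t\<bar> \<ge> L / 2"
  shows "\<bar>integral {\<alpha>..\<beta>} (\<lambda>t. A t * cos (\<psi> t))\<bar> \<le> ((1 + pi) / q + pi * K + 4 * M) / sqrt L"
proof -
  define d where "d = sqrt L"
  have d: "d > 0" "d\<^sup>2 = L" "d \<ge> 1" using assms by (auto simp: d_def)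
  define w where "w = (\<lambda>t. (D t)\<^sup>2 + L)"
  define F where "F = (\<lambda>t. sin (\<psi> t) * (D t / w t) / q)"
  \<comment> \<open>As \<open>d\<^sup>2 = L\<close>, the factor equals
    \<open>(K + 1 / q) / d\<close>; it makes the derivative exactly
    \<open>(K + 1 / q) * D' t / w t\<close>.\<close>
  define G where "G = (\<lambda>t. (K / L * d + 1 / (q * d)) * arctan (D t / d))"
  have w: "w t > 0" "w t \<noteq> 0" "w t \<ge> L" for t
    using assms(3) zero_le_power2[of "D t"] unfolding w_def by linarith+
  define f where "f = (\<lambda>t. A t * cos (\<psi> t))"
  define F' where "F' = (\<lambda>t. A t * cos (\<psi> t) * ((D t)\<^sup>2 / w t)
      + sin (\<psi> t) * ((L - (D t)\<^sup>2) * D' t / (w t)\<^sup>2) / q)"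
  define G' where "G' = (\<lambda>t. (K + 1 / q) * D' t / w t)"
  have dF: "(F has_real_derivative F' t) (at t)" if t: "t \<in> {\<alpha>..\<beta>}" for t
  proof -
    have "(w has_real_derivative 2 * D t * D' t) (at t)"
      unfolding w_def by (rule derivative_eq_intros D[OF t] refl | simp)+
    from DERIV_divide[OF D[OF t] this w(2)]
    have "((\<lambda>t. D t / w t) has_real_derivative (L - (D t)\<^sup>2) * D' t / (w t)\<^sup>2) (at t)"
      by (simp add: w_def power2_eq_square algebra_simps)
    note DERIV_cdivide[OF DERIV_mult'[OF DERIV_fun_sin[OF \<psi>[OF t]] this], of q]
    then show ?thesis
      unfolding F_def F'_def using assms(2) by (simp add: power2_eq_square add_divide_distrib add.commute mult_ac)
  qed
  have dG: "(G has_real_derivative G' t) (at t)" if t: "t \<in> {\<alpha>..\<beta>}" for t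
  proof -
    have e: "1 + (D t / d)\<^sup>2 = w t / d\<^sup>2"
      using assms(3) d(2) by (simp add: w_def power_divide add_divide_distrib)
    have "(G has_real_derivative (K / L * d + 1 / (q * d)) * (inverse (1 + (D t / d)\<^sup>2) * (D' t / d))) (at t)"
      unfolding G_def
      by (rule DERIV_cmult[OF DERIV_chain2[OF DERIV_arctan DERIV_cdivide[OF D[OF t]]]])
    also have "(K / L * d + 1 / (q * d)) * (inverse (1 + (D t / d)\<^sup>2) * (D' t / d)) = G' t"
      unfolding e G'_def d(2)[symmetric] using d(1) w(2)[of t] assms(2)
      by (simp add: divide_simps) (simp add: power2_eq_square algebra_simps)
    finally show ?thesis .
  qed
  have iF: "(F' has_integral F \<beta> - F \<alpha>) {\<alpha>..\<beta>}"
    by (intro fundamental_theorem_of_calculus assms(1))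
      (auto simp: has_real_derivative_iff_has_vector_derivative[symmetric]
        intro!: has_field_derivative_at_within dF)
  have iG: "(G' has_integral G \<beta> - G \<alpha>) {\<alpha>..\<beta>}"
    by (intro fundamental_theorem_of_calculus assms(1))
      (auto simp: has_real_derivative_iff_has_vector_derivative[symmetric]
        intro!: has_field_derivative_at_within dG)
  have iA: "(A has_integral integral {\<alpha>..\<beta>} A) {\<alpha>..\<beta>}"
    using A(1) by (intro integrable_integral integrable_continuous_real)
  have c\<psi>: "continuous_on {\<alpha>..\<beta>} \<psi>"
    using \<psi> by (meson DERIV_isCont continuous_at_imp_continuous_on)
  have if': "(f has_integral integral {\<alpha>..\<beta>} f) {\<alpha>..\<beta>}"
    unfolding f_def by (intro integrable_integral integrable_continuous_real continuous_intros c\<psi> A(1))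
  have iH: "((\<lambda>t. G' t + 4 / L * A t) has_integral (G \<beta> - G \<alpha> + 4 / L * integral {\<alpha>..\<beta>} A)) {\<alpha>..\<beta>}"
    by (intro has_integral_add iG has_integral_mult_right iA)
  have ptw: "norm (f t - F' t) \<le> G' t + 4 / L * A t" if t: "t \<in> {\<alpha>..\<beta>}" for t
  proof -
    \<comment> \<open>\<open>F'\<close> contains the fraction \<open>(D t)\<^sup>2 / w t\<close> of
      the integrand, so only the fraction \<open>L / w t\<close> of it is left over.\<close>
    have "f t - F' t = A t * cos (\<psi> t) * (L / w t)
        - sin (\<psi> t) * ((L - (D t)\<^sup>2) * D' t / (w t)\<^sup>2) / q"
    proof -
      have "(D t)\<^sup>2 / w t = 1 - L / w t" using w(2)[of t] by (simp add: w_def field_simps)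
      then show ?thesis unfolding f_def F'_def by (simp only:) (simp add: algebra_simps)
    qed
    also have "norm \<dots> \<le> \<bar>A t * cos (\<psi> t) * (L / w t)\<bar>
        + \<bar>sin (\<psi> t) * ((L - (D t)\<^sup>2) * D' t / (w t)\<^sup>2) / q\<bar>"
      unfolding real_norm_def by (rule abs_triangle_ineq4)
    also have "\<dots> \<le> A t * (L / w t) + D' t / w t / q"
    proof (rule add_mono)
      have "\<bar>A t * cos (\<psi> t) * (L / w t)\<bar> = A t * (L / w t) * \<bar>cos (\<psi> t)\<bar>"
        using A(2)[OF t] w(1)[of t] assms(3) by (simp add: abs_mult)
      also have "\<dots> \<le> A t * (L / w t) * 1"
        using A(2)[OF t] w(1)[of t] assms(3) by (intro mult_left_mono) auto
      finally show "\<bar>A t * cos (\<psi> t) * (L / w t)\<bar> \<le> A t * (L / w t)" by simp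
      have "\<bar>L - (D t)\<^sup>2\<bar> \<le> w t" using assms(3) by (simp add: w_def abs_le_iff)
      then have *: "\<bar>L - (D t)\<^sup>2\<bar> / (w t)\<^sup>2 \<le> 1 / w t"
        using w(1)[of t] by (simp add: power2_eq_square field_simps)
      have "\<bar>sin (\<psi> t) * ((L - (D t)\<^sup>2) * D' t / (w t)\<^sup>2) / q\<bar>
        = (\<bar>L - (D t)\<^sup>2\<bar> / (w t)\<^sup>2) * (D' t / q) * \<bar>sin (\<psi> t)\<bar>"
        using D'[OF t] assms(2) by (simp add: abs_mult)
      also have "\<dots> \<le> (1 / w t) * (D' t / q) * 1"
        using D'[OF t] assms(2) w(1)[of t] * by (intro mult_mono) auto
      finally show "\<bar>sin (\<psi> t) * ((L - (D t)\<^sup>2) * D' t / (w t)\<^sup>2) / q\<bar> \<le> D' t / w t / q"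
        by simp
    qed
    \<comment> \<open>Near stationary points \<open>A\<close> is charged to the arctangent term;
      elsewhere \<open>\<bar>D t\<bar> \<ge> L / 2\<close> gives
      \<open>w t \<ge> L\<^sup>2 / 4\<close>, hence \<open>L / w t \<le> 4 / L\<close>.\<close>
    also have "A t * (L / w t) \<le> K * D' t / w t + 4 / L * A t"
    proof (cases "A t \<le> K / L * D' t")
      case True
      have "A t * (L / w t) \<le> (K / L * D' t) * (L / w t)"
        using True w(1)[of t] assms(3) by (intro mult_right_mono) auto
      also have "\<dots> = K * D' t / w t" using assms(3) by simp
      finally show ?thesis using A(2)[OF t] assms(3) by (simp add: add_increasing2)
    next
      case False
      then have "\<bar>D t\<bar> \<ge> L / 2" using alt[OF t] by blast
      then have "(L / 2)\<^sup>2 \<le> (D t)\<^sup>2" using assms(3) abs_le_square_iff[of "L/2" "D t"] by simp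
      then have "L\<^sup>2 \<le> 4 * w t" using assms(3) by (simp add: w_def power_divide)
      then have "L / w t \<le> 4 / L" using w(1)[of t] assms(3) by (simp add: field_simps power2_eq_square)
      then have "A t * (L / w t) \<le> 4 / L * A t"
        using A(2)[OF t] by (metis mult.commute mult_right_mono)
      then show ?thesis using D'[OF t] w(1)[of t] assms(4) by (simp add: add_increasing)
    qed
    finally show ?thesis by (simp add: G'_def algebra_simps add_divide_distrib)
  qed
  have "norm (integral {\<alpha>..\<beta>} (\<lambda>t. f t - F' t)) \<le> integral {\<alpha>..\<beta>} (\<lambda>t. G' t + 4 / L * A t)"
    using has_integral_diff[OF if' iF] iH ptw
    by (intro Henstock_Kurzweil_Integration.integral_norm_bound_integral) auto
  then have main: "\<bar>integral {\<alpha>..\<beta>} f - (F \<beta> - F \<alpha>)\<bar> \<le> G \<beta> - G \<alpha> + 4 / L * integral {\<alpha>..\<beta>} A"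
    using integral_unique[OF has_integral_diff[OF if' iF]] integral_unique[OF iH] by simp
  have Fb: "\<bar>F t\<bar> \<le> 1 / (2 * q * d)" for t
  proof -
    \<comment> \<open>The inequality of arithmetic and geometric means for
      \<open>(D t)\<^sup>2\<close> and \<open>L\<close>.\<close>
    have "2 * \<bar>D t\<bar> * d \<le> w t" 
      using zero_le_power2[of "\<bar>D t\<bar> - d"] d(2) by (simp add: w_def power2_diff)
    then have *: "\<bar>D t / w t\<bar> \<le> 1 / (2 * d)" using w(1)[of t] d by (simp add: field_simps)
    have "\<bar>F t\<bar> = \<bar>sin (\<psi> t)\<bar> * \<bar>D t / w t\<bar> / q"
      using assms(2) by (simp add: F_def abs_mult)
    also have "\<dots> \<le> 1 * (1 / (2 * d)) / q"
      using * assms(2) d by (intro divide_right_mono mult_mono) auto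
    finally show ?thesis by (simp add: field_simps)
  qed
  have Gb: "G \<beta> - G \<alpha> \<le> (K / L * d + 1 / (q * d)) * pi"
  proof -
    have "arctan (D \<beta> / d) - arctan (D \<alpha> / d) \<le> pi"
      using arctan_ubound[of "D \<beta> / d"] arctan_lbound[of "D \<alpha> / d"] by linarith
    then show ?thesis unfolding G_def right_diff_distrib[symmetric]
      using assms d by (intro mult_left_mono) auto
  qed
  \<comment> \<open>Here \<open>L \<ge> 1\<close> enters: it weakens the decay 1 / \<open>L\<close>
    of the last term to 1 / \<open>d\<close>.\<close>
  have "d * 1 \<le> d * d" using d by (intro mult_left_mono) auto
  then have "d \<le> L" using d(2) by (simp add: power2_eq_square)
  have "0 \<le> integral {\<alpha>..\<beta>} A" using A(2) iA by (intro integral_nonneg) auto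
  then have Ab: "4 / L * integral {\<alpha>..\<beta>} A \<le> 4 / d * M"
    using M d \<open>d \<le> L\<close> by (intro mult_mono frac_le) auto
  have "\<bar>integral {\<alpha>..\<beta>} f\<bar> \<le> 1 / (q * d) + (K / L * d + 1 / (q * d)) * pi + 4 / d * M"
  proof -
    have "1 / (2 * q * d) + 1 / (2 * q * d) = 1 / (q * d)" using assms(2) d by (simp add: field_simps)
    moreover have "\<bar>I\<bar> \<le> c2 + G1 + E1"
      if "\<bar>I - (y - x)\<bar> \<le> g + e" "g \<le> G1" "e \<le> E1" "\<bar>x\<bar> \<le> c" "\<bar>y\<bar> \<le> c" "c + c = c2"
      for I x y g e c c2 G1 E1 :: real
      using that by linarith
    ultimately show ?thesis using main Gb Ab Fb[of \<alpha>] Fb[of \<beta>] by blast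
  qed
  also have "\<dots> = ((1 + pi) / q + pi * K + 4 * M) / d"
    using assms(2) d unfolding d(2)[symmetric] by (simp add: field_simps power2_eq_square)
  finally show ?thesis unfolding f_def d_def .
qed

text \<open>Cosine is even, so negating \<psi>, \<open>D\<close> and \<open>D'\<close> reduces a
  decreasing \<open>D\<close> to an increasing one.\<close>

lemma oscillatory_integral_bound_signed:
  fixes A D D' \<psi> :: "real \<Rightarrow> real"
  assumes "\<alpha> \<le> \<beta>" "q > 0" "L \<ge> 1" "K \<ge> 0"
    and \<psi>: "\<And>t. t \<in> {\<alpha>..\<beta>} \<Longrightarrow> (\<psi> has_real_derivative q * A t * D t) (at t)"
    and D: "\<And>t. t \<in> {\<alpha>..\<beta>} \<Longrightarrow> (D has_real_derivative D' t) (at t)"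
    and D': "(\<forall>t\<in>{\<alpha>..\<beta>}. 0 \<le> D' t) \<or> (\<forall>t\<in>{\<alpha>..\<beta>}. D' t \<le> 0)"
    and A: "continuous_on {\<alpha>..\<beta>} A" "\<And>t. t \<in> {\<alpha>..\<beta>} \<Longrightarrow> 0 \<le> A t"
    and M: "integral {\<alpha>..\<beta>} A \<le> M"
    and alt: "\<And>t. t \<in> {\<alpha>..\<beta>} \<Longrightarrow> A t \<le> K / L * \<bar>D' t\<bar> \<or> \<bar>D t\<bar> \<ge> L / 2"
  shows "\<bar>integral {\<alpha>..\<beta>} (\<lambda>t. A t * cos (\<psi> t))\<bar> \<le> ((1 + pi) / q + pi * K + 4 * M) / sqrt L"
  using D'
proof
  assume pos: "\<forall>t\<in>{\<alpha>..\<beta>}. 0 \<le> D' t"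
  show ?thesis
    by (rule oscillatory_integral_bound_mono[OF assms(1-4) \<psi> D _ A M]) (use pos alt in auto)
next
  assume neg: "\<forall>t\<in>{\<alpha>..\<beta>}. D' t \<le> 0"
  have "\<bar>integral {\<alpha>..\<beta>} (\<lambda>t. A t * cos (- \<psi> t))\<bar> \<le> ((1 + pi) / q + pi * K + 4 * M) / sqrt L"
  proof (rule oscillatory_integral_bound_mono[OF assms(1-4) _ _ _ A M,
        where D = "\<lambda>t. - D t" and D' = "\<lambda>t. - D' t"])
    fix t assume t: "t \<in> {\<alpha>..\<beta>}"
    show "((\<lambda>t. - \<psi> t) has_real_derivative q * A t * - D t) (at t)"
      using DERIV_minus[OF \<psi>[OF t]] by simp
    show "((\<lambda>t. - D t) has_real_derivative - D' t) (at t)"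
      by (rule DERIV_minus[OF D[OF t]])
    show "A t \<le> K / L * - D' t \<or> L / 2 \<le> \<bar>- D t\<bar>"
      using alt[OF t] neg t by (simp add: abs_of_nonpos)
  qed (use neg in auto)
  then show ?thesis by simp
qed

section \<open>The two Bessel phases on compact subintervals of (0, 1)\<close>

text \<open>Applied to \<open>h\<close> with \<open>D' = (q - 1) h\<close>, this cuts the interval
  where \<open>D\<close> changes its direction of monotonicity. The cut is a zero of
  \<open>h\<close>, or an endpoint if \<open>h\<close> keeps a strict sign; one piece is then a
  single point.\<close>

lemma mono_constant_sign_pieces:
  fixes h :: "real \<Rightarrow> real"
  assumes "\<alpha> \<le> \<beta>" "continuous_on {\<alpha>..\<beta>} h" "mono_on {\<alpha>..\<beta>} h"
  obtains c where "c \<in> {\<alpha>..\<beta>}"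
    "(\<forall>t\<in>{\<alpha>..c}. 0 \<le> h t) \<or> (\<forall>t\<in>{\<alpha>..c}. h t \<le> 0)"
    "(\<forall>t\<in>{c..\<beta>}. 0 \<le> h t) \<or> (\<forall>t\<in>{c..\<beta>}. h t \<le> 0)"
proof -
  have mono: "h s \<le> h t" if "\<alpha> \<le> s" "s \<le> t" "t \<le> \<beta>" for s t
    using mono_onD[OF assms(3)] that by auto
  consider "h \<alpha> > 0" | "h \<beta> < 0" | "h \<alpha> \<le> 0" "0 \<le> h \<beta>" by linarith
  then show ?thesis
  proof cases
    case 1
    then have "\<forall>t\<in>{\<alpha>..\<beta>}. 0 \<le> h t" using mono[of \<alpha>] by fastforce
    then show ?thesis using that[of \<alpha>] assms(1) by simp
  next
    case 2
    then have "\<forall>t\<in>{\<alpha>..\<beta>}. h t \<le> 0" using mono[of _ \<beta>] by fastforce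
    then show ?thesis using that[of \<beta>] assms(1) by simp
  next
    case 3
    then obtain c where c: "\<alpha> \<le> c" "c \<le> \<beta>" "h c = 0"
      using IVT'[of h \<alpha> 0 \<beta>] assms by auto
    then have "\<forall>t\<in>{\<alpha>..c}. h t \<le> 0" "\<forall>t\<in>{c..\<beta>}. 0 \<le> h t"
      using mono[of _ c] mono[of c] by fastforce+
    then show ?thesis using that[of c] c by simp
  qed
qed

text \<open>\<open>D\<close> is monotone on at most two pieces, whence the leading factor 2. The
  bound does not depend on \<alpha> and \<beta>, which allows the passage to the full interval;
  staying inside (0, 1) avoids the singular endpoints.\<close>

lemma bessel_phase_integral_bound:
  fixes q a b \<sigma> :: real
  assumes q: "q = 1 / 2 \<or> q > 1" and ab: "0 \<le> a" "0 \<le> b" "1 \<le> max a b"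
    and \<sigma>: "\<sigma> = 1 \<or> \<sigma> = -1" and \<alpha>\<beta>: "0 < \<alpha>" "\<alpha> \<le> \<beta>" "\<beta> < 1"
  shows "\<bar>integral {\<alpha>..\<beta>} (\<lambda>t. t powr (q - 1) * (1 - t) powr (q - 1) *
            cos (a * t powr q + \<sigma> * b * (1 - t) powr q))\<bar>
      \<le> 2 * ((1 + pi) / q + pi * (4 + 1 / \<bar>q - 1\<bar>) + 4 * Beta q q) / sqrt (max a b)"
proof -
  define L where "L = max a b"
  define A where "A = (\<lambda>t::real. t powr (q - 1) * (1 - t) powr (q - 1))"
  define D where "D = (\<lambda>t::real. a * (1 - t) powr (1 - q) - \<sigma> * b * t powr (1 - q))"
  define h where "h = (\<lambda>t::real. a * (1 - t) powr (- q) + \<sigma> * b * t powr (- q))"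
  define D' where "D' = (\<lambda>t::real. (q - 1) * h t)"
  define \<psi> where "\<psi> = (\<lambda>t::real. a * t powr q + \<sigma> * b * (1 - t) powr q)"
  \<comment> \<open>One constant for both regimes: 4 serves \<open>q = 1 / 2\<close>, and 1 /
    (\<open>q\<close> - 1) serves \<open>q > 1\<close>.\<close>
  define K where "K = 4 + 1 / \<bar>q - 1\<bar>"
  have q0: "q > 0" using q by auto
  have L: "L \<ge> 1" "a \<le> L" "b \<le> L" "L = a \<or> L = b" using ab by (auto simp: L_def max_def)
  have t01: "0 < t" "t < 1" if "t \<in> {\<alpha>..\<beta>}" for t using that \<alpha>\<beta> by auto
  have inv: "x powr (q - 1) * x powr (1 - q) = 1" if "x > 0" for x :: real
    using that by (simp flip: powr_add)
  have d\<psi>: "(\<psi> has_real_derivative q * A t * D t) (at t)" if t: "t \<in> {\<alpha>..\<beta>}" for t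
  proof -
    have "(\<psi> has_real_derivative q * (a * t powr (q - 1) - \<sigma> * b * (1 - t) powr (q - 1))) (at t)"
      unfolding \<psi>_def using t01[OF t]
      by (auto intro!: derivative_eq_intros simp: algebra_simps)
    \<comment> \<open>Taking out the symmetric factor \<open>A\<close> turns
      \<open>t powr (q - 1)\<close> into \<open>(1 - t) powr (1 - q)\<close> and vice versa.\<close>
    also have "a * t powr (q - 1) - \<sigma> * b * (1 - t) powr (q - 1) = A t * D t"
    proof -
      have "A t * D t = a * t powr (q - 1) * ((1 - t) powr (q - 1) * (1 - t) powr (1 - q))
          - \<sigma> * b * (1 - t) powr (q - 1) * (t powr (q - 1) * t powr (1 - q))"
        by (simp add: A_def D_def algebra_simps)
      then show ?thesis using inv[of t] inv[of "1 - t"] t01[OF t] by simp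
    qed
    finally show ?thesis by (simp add: mult.assoc)
  qed
  have dD: "(D has_real_derivative D' t) (at t)" if t: "t \<in> {\<alpha>..\<beta>}" for t
    unfolding D_def D'_def h_def using t01[OF t]
    by (auto intro!: derivative_eq_intros simp: algebra_simps)
  have cA: "continuous_on {\<alpha>..\<beta>} A"
    unfolding A_def by (intro continuous_intros) (use t01 in force)+
  have A0: "0 \<le> A t" for t by (simp add: A_def)
  have iA: "(A has_integral Beta q q) {0..1}"
    unfolding A_def by (rule has_integral_Beta_real[OF q0 q0])
  have alt: "A t \<le> K / L * \<bar>D' t\<bar> \<or> L / 2 \<le> \<bar>D t\<bar>" if t: "t \<in> {\<alpha>..\<beta>}" for t
  proof (cases "q > 1")
    case True
    have ge1: "x powr - r \<ge> 1" if "0 < x" "x < 1" "r \<ge> 0" for x r :: real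
      using that powr_mono'[of "-r" 0 x] by simp
    have A1: "A t \<le> 1"
      unfolding A_def using t01[OF t] True by (intro mult_le_one powr_le1) auto
    show ?thesis
    proof (cases "\<sigma> = 1")
      case sg: True
      have "a * 1 \<le> a * (1 - t) powr - q" "b * 1 \<le> b * t powr - q"
        using ge1[of "1 - t" q] ge1[of t q] t01[OF t] q0 ab by (intro mult_left_mono; simp)+
      moreover have "0 \<le> a * (1 - t) powr - q" "0 \<le> b * t powr - q" using ab by auto
      ultimately have "L \<le> h t" unfolding h_def sg using L(4) by linarith
      then have "(q - 1) * L \<le> \<bar>D' t\<bar>"
        unfolding D'_def using True L by (simp add: abs_mult)
      then have "1 / (q - 1) * ((q - 1) * L) \<le> K * \<bar>D' t\<bar>"
        using True L by (intro mult_mono) (auto simp: K_def)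
      then have "L \<le> K * \<bar>D' t\<bar>" using True by simp
      then have "1 \<le> K / L * \<bar>D' t\<bar>" using L(1) by simp
      then show ?thesis using A1 by linarith
    next
      case False
      then have sg: "\<sigma> = -1" using \<sigma> by simp
      have "a * 1 \<le> a * (1 - t) powr - (q - 1)" "b * 1 \<le> b * t powr - (q - 1)"
        using ge1[of "1 - t" "q - 1"] ge1[of t "q - 1"] t01[OF t] True ab
        by (intro mult_left_mono; simp)+
      moreover have "0 \<le> a * (1 - t) powr - (q - 1)" "0 \<le> b * t powr - (q - 1)" using ab by auto
      ultimately have "L \<le> D t" unfolding D_def sg using L(4) by auto
      then show ?thesis using L by auto
    qed
  next
    case False
    then have q: "q = 1 / 2" using q by simp
    define u v where "u = sqrt t" and "v = sqrt (1 - t)"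
    have uv: "u > 0" "v > 0" "u\<^sup>2 + v\<^sup>2 = 1" using t01[OF t] by (auto simp: u_def v_def)
    have pw: "t powr (1/2) = u" "(1 - t) powr (1/2) = v"
      "t powr - (1/2) = 1 / u" "(1 - t) powr - (1/2) = 1 / v"
      using t01[OF t] by (auto simp: u_def v_def powr_half_sqrt powr_minus inverse_eq_divide)
    define E where "E = a * u + \<sigma> * b * v"
    have Dt: "D t = a * v - \<sigma> * b * u" by (simp add: D_def q pw)
    have At: "A t = 1 / (u * v)" by (simp add: A_def q pw)
    have D't: "D' t = - (1 / 2) * A t * E"
      unfolding D'_def h_def At E_def q using uv by (simp add: pw field_simps)
    have "\<sigma>\<^sup>2 = 1" using \<sigma> by auto
    \<comment> \<open>The pair (\<open>E\<close>, \<open>D t\<close>) is the image of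
      (\<open>a\<close>, \<open>\<sigma> * b\<close>) under an orthogonal matrix with entries
      \<open>u\<close>, \<open>v\<close>, \<open>v\<close>, \<open>- u\<close>.\<close>
    have "E\<^sup>2 + (D t)\<^sup>2 = (a\<^sup>2 + \<sigma>\<^sup>2 * b\<^sup>2) * (u\<^sup>2 + v\<^sup>2)"
      unfolding E_def Dt by (simp add: power2_eq_square algebra_simps)
    then have ED: "E\<^sup>2 + (D t)\<^sup>2 = a\<^sup>2 + b\<^sup>2" using uv \<open>\<sigma>\<^sup>2 = 1\<close> by simp
    show ?thesis
    proof (cases "L / 2 \<le> \<bar>D t\<bar>")
      case D: False
      \<comment> \<open>A small \<open>D t\<close> leaves at least three quarters of
        \<open>L\<^sup>2\<close> for \<open>E\<^sup>2\<close>. The weaker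
        \<open>\<bar>E\<bar> \<ge> L / 2\<close> suffices, and together with
        \<open>\<bar>D' t\<bar> = A t * \<bar>E\<bar> / 2\<close> it produces the constant
        4.\<close>
      then have "\<bar>D t\<bar>\<^sup>2 \<le> (L / 2)\<^sup>2" by (intro power_mono) auto
      moreover have "L\<^sup>2 \<le> a\<^sup>2 + b\<^sup>2" using L(4) by auto
      ultimately have "(L / 2)\<^sup>2 \<le> E\<^sup>2"
        using ED by (simp add: power_divide) (smt (verit) zero_le_power2)
      then have "L / 2 \<le> \<bar>E\<bar>" using L abs_le_square_iff[of "L / 2" E] by simp
      then have "A t * (L / 2) \<le> A t * \<bar>E\<bar>" using A0 by (intro mult_left_mono)
      moreover have "\<bar>D' t\<bar> = A t * \<bar>E\<bar> / 2" unfolding D't using A0[of t] by (simp add: abs_mult)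
      ultimately have "A t * L \<le> 4 * \<bar>D' t\<bar>" by simp
      also have "\<dots> \<le> K * \<bar>D' t\<bar>" by (intro mult_right_mono) (auto simp: K_def)
      finally show ?thesis using L by (simp add: field_simps)
    qed simp
  qed
  have piece: "\<bar>integral {x..y} (\<lambda>t. A t * cos (\<psi> t))\<bar>
      \<le> ((1 + pi) / q + pi * K + 4 * Beta q q) / sqrt L"
    if xy: "x \<le> y" "{x..y} \<subseteq> {\<alpha>..\<beta>}"
      and sgn: "(\<forall>t\<in>{x..y}. 0 \<le> h t) \<or> (\<forall>t\<in>{x..y}. h t \<le> 0)" for x y
  proof (rule oscillatory_integral_bound_signed[where D = D and D' = D'])
    show "(\<forall>t\<in>{x..y}. 0 \<le> D' t) \<or> (\<forall>t\<in>{x..y}. D' t \<le> 0)"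
      using sgn unfolding D'_def by (cases "q \<ge> 1")
        (auto simp: mult_nonneg_nonneg mult_nonneg_nonpos mult_nonpos_nonneg mult_nonpos_nonpos)
    \<comment> \<open>The mass of \<open>A\<close> is bounded by that on the whole unit interval, so
      that the constant is the same for every piece.\<close>
    have "{x..y} \<subseteq> {0..1}" using xy \<alpha>\<beta> by auto
    then show "integral {x..y} A \<le> Beta q q"
      unfolding integral_unique[OF iA, symmetric]
      using iA A0 integrable_on_subinterval[of A "{0..1}" x y] by (intro integral_subset_le) auto
    show "continuous_on {x..y} A" using cA xy(2) by (rule continuous_on_subset)
    show "K \<ge> 0" by (simp add: K_def)
  qed (use xy d\<psi> dD A0 alt L q0 in \<open>auto simp: subset_iff\<close>)
  \<comment> \<open>For \<sigma> = 1 both summands of \<open>h\<close> are nonnegative. For \<sigma>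
    = -1, \<open>h\<close> is the nondecreasing \<open>a * (1 - t) powr - q\<close> minus the
    nonincreasing \<open>b * t powr - q\<close>.\<close>
  have "mono_on {\<alpha>..\<beta>} h \<or> (\<forall>t\<in>{\<alpha>..\<beta>}. 0 \<le> h t)"
  proof (cases "\<sigma> = 1")
    case False
    then have sg: "\<sigma> = -1" using \<sigma> by simp
    have "mono_on {\<alpha>..\<beta>} h"
    proof (rule mono_onI)
      fix s t assume "s \<in> {\<alpha>..\<beta>}" "t \<in> {\<alpha>..\<beta>}" "s \<le> t"
      then have "a * (1 - s) powr - q \<le> a * (1 - t) powr - q" "b * t powr - q \<le> b * s powr - q"
        using t01[of s] t01[of t] q0 ab by (intro mult_left_mono powr_mono2'; simp)+
      then show "h s \<le> h t" by (simp add: h_def sg)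
    qed
    then show ?thesis ..
  qed (use ab in \<open>auto simp: h_def\<close>)
  then obtain c where c: "c \<in> {\<alpha>..\<beta>}"
    "(\<forall>t\<in>{\<alpha>..c}. 0 \<le> h t) \<or> (\<forall>t\<in>{\<alpha>..c}. h t \<le> 0)"
    "(\<forall>t\<in>{c..\<beta>}. 0 \<le> h t) \<or> (\<forall>t\<in>{c..\<beta>}. h t \<le> 0)"
  proof
    assume "mono_on {\<alpha>..\<beta>} h"
    moreover have "continuous_on {\<alpha>..\<beta>} h"
      unfolding h_def by (intro continuous_intros) (use t01 in force)+
    ultimately show ?thesis using mono_constant_sign_pieces[of \<alpha> \<beta> h] \<alpha>\<beta> that by blast
  qed (use that[of \<alpha>] \<alpha>\<beta> in auto)
  have "(\<lambda>t. A t * cos (\<psi> t)) integrable_on {\<alpha>..\<beta>}"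
    using d\<psi> by (intro integrable_continuous_real continuous_intros cA)
      (meson DERIV_isCont continuous_at_imp_continuous_on)
  then have "integral {\<alpha>..\<beta>} (\<lambda>t. A t * cos (\<psi> t))
      = integral {\<alpha>..c} (\<lambda>t. A t * cos (\<psi> t)) + integral {c..\<beta>} (\<lambda>t. A t * cos (\<psi> t))"
    using c(1) by (intro Henstock_Kurzweil_Integration.integral_combine[symmetric]) auto
  also have "\<bar>\<dots>\<bar> \<le> ((1 + pi) / q + pi * K + 4 * Beta q q) / sqrt L
      + ((1 + pi) / q + pi * K + 4 * Beta q q) / sqrt L"
    using c by (intro order_trans[OF abs_triangle_ineq add_mono] piece) auto
  finally have "\<bar>integral {\<alpha>..\<beta>} (\<lambda>t. A t * cos (\<psi> t))\<bar>
      \<le> 2 * ((1 + pi) / q + pi * K + 4 * Beta q q) / sqrt L"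
    by (simp only: add_divide_distrib[symmetric] mult_2[symmetric] times_divide_eq_right)
  then show ?thesis unfolding A_def \<psi>_def L_def K_def .
qed

section \<open>The integral over the whole unit interval\<close>

text \<open>The indefinite integral of an integrable function is continuous up to the endpoints, so
  a uniform bound survives the limits \<open>x\<close> to \<open>a\<close> and then \<open>y\<close>
  to \<open>b\<close>. This reaches endpoints at which the Bessel integrand is singular.\<close>

lemma abs_integral_le_of_compact_subintervals:
  fixes f :: "real \<Rightarrow> real"
  assumes "a < b" "0 \<le> B"
    and B: "\<And>x y. a < x \<Longrightarrow> x \<le> y \<Longrightarrow> y < b \<Longrightarrow> \<bar>integral {x..y} f\<bar> \<le> B"
  shows "\<bar>integral {a..b} f\<bar> \<le> B"
proof (cases "f integrable_on {a..b}")
  case True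
  define F where "F = (\<lambda>x. integral {a..x} f)"
  have cF: "continuous_on {a..b} F"
    unfolding F_def by (rule indefinite_integral_continuous_1[OF True])
  have le: "\<bar>F y - F x\<bar> \<le> B" if "a < x" "x \<le> y" "y < b" for x y
  proof -
    have "f integrable_on {a..y}"
      using that by (intro integrable_on_subinterval[OF True]) auto
    then have "F x + integral {x..y} f = F y"
      unfolding F_def using that by (intro Henstock_Kurzweil_Integration.integral_combine) auto
    then show ?thesis using B[OF that] by simp
  qed
  define m where "m = (a + b) / 2"
  have m: "a < m" "m < b" using assms(1) by (auto simp: m_def)
  have Fa: "(F \<longlongrightarrow> F a) (at_right a)" and Fb: "(F \<longlongrightarrow> F b) (at_left b)"
    using cF assms(1) by (auto simp: continuous_on_Icc_at_rightD continuous_on_Icc_at_leftD)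
  have 1: "\<bar>F y - F a\<bar> \<le> B" if y: "a < y" "y < b" for y
  proof (rule tendsto_upperbound)
    show "((\<lambda>x. \<bar>F y - F x\<bar>) \<longlongrightarrow> \<bar>F y - F a\<bar>) (at_right a)"
      by (intro tendsto_intros Fa)
    show "\<forall>\<^sub>F x in at_right a. \<bar>F y - F x\<bar> \<le> B"
      unfolding eventually_at_right_field using y le by (intro exI[of _ y]) auto
  qed simp
  have "\<bar>F b - F a\<bar> \<le> B"
  proof (rule tendsto_upperbound)
    show "((\<lambda>y. \<bar>F y - F a\<bar>) \<longlongrightarrow> \<bar>F b - F a\<bar>) (at_left b)"
      by (intro tendsto_intros Fb)
    show "\<forall>\<^sub>F y in at_left b. \<bar>F y - F a\<bar> \<le> B"
      unfolding eventually_at_left_field using 1 assms(1) by (intro exI[of _ a]) auto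
  qed simp
  then show ?thesis by (simp add: F_def)
qed (use assms(2) in \<open>simp add: not_integrable_integral\<close>) \<comment> \<open>junk value \<open>0\<close>\<close>

text \<open>The product of cosines is the mean of the cosines of the sum and of the difference, that
  is, of the phases with \<sigma> = 1 and \<sigma> = -1, and a mean of two quantities obeys their
  common bound. Evenness of cosine permits absolute values of \<open>a\<close> and
  \<open>b\<close>.\<close>

lemma gen_bessel0_integral_bound:
  fixes q a b :: real
  assumes q: "q = 1 / 2 \<or> q > 1" and ab: "1 \<le> max \<bar>a\<bar> \<bar>b\<bar>"
  shows "\<bar>integral {0..1} (\<lambda>t. cos (a * t powr q) * cos (b * (1 - t) powr q) *
            t powr (q - 1) * (1 - t) powr (q - 1))\<bar>
      \<le> 2 * ((1 + pi) / q + pi * (4 + 1 / \<bar>q - 1\<bar>) + 4 * Beta q q) / sqrt (max \<bar>a\<bar> \<bar>b\<bar>)"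
    (is "\<bar>integral _ ?f\<bar> \<le> ?B")
proof (rule abs_integral_le_of_compact_subintervals)
  define g where "g = (\<lambda>\<sigma> t. t powr (q - 1) * (1 - t) powr (q - 1) *
            cos (\<bar>a\<bar> * t powr q + \<sigma> * \<bar>b\<bar> * (1 - t) powr q))"
  have q0: "q > 0" using q by auto
  show le: "\<bar>integral {x..y} ?f\<bar> \<le> ?B" if xy: "0 < x" "x \<le> y" "y < 1" for x y
  proof -
    have cosabs: "cos (\<bar>c\<bar> * u) = cos (c * u)" for c u :: real by (simp add: abs_if)
    have f: "?f t = (g 1 t + g (-1) t) / 2" for t
      unfolding g_def by (simp add: cos_add cos_diff cosabs algebra_simps)
    have "g \<sigma> integrable_on {x..y}" for \<sigma>
      unfolding g_def by (intro integrable_continuous_real continuous_intros) (use xy q0 in auto)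
    then have "integral {x..y} ?f = (integral {x..y} (g 1) + integral {x..y} (g (-1))) / 2"
      unfolding f by (simp add: integral_add)
    moreover have "\<bar>integral {x..y} (g \<sigma>)\<bar> \<le> ?B" if "\<sigma> = 1 \<or> \<sigma> = -1" for \<sigma>
      unfolding g_def using q ab that xy by (intro bessel_phase_integral_bound) auto
    from this[of 1] this[of "-1"] have "\<bar>integral {x..y} (g 1)\<bar> \<le> ?B" "\<bar>integral {x..y} (g (-1))\<bar> \<le> ?B"
      by auto
    ultimately have "\<bar>integral {x..y} ?f\<bar> \<le> (?B + ?B) / 2"
      by (simp only: abs_divide abs_numeral divide_right_mono zero_le_numeral
          order_trans[OF abs_triangle_ineq add_mono])
    moreover have "(z + z) / 2 = z" for z :: real by simp
    ultimately show ?thesis by (simp only:)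
  qed
  \<comment> \<open>On a one-point interval the integral is 0, and its absolute value is below the
    bound.\<close>
  show "0 \<le> ?B" using le[of "1/2" "1/2"] by simp
qed simp

section \<open>The p-norm and generalised polar coordinates\<close>

lemma pnorm_le_max:
  assumes "p > 0"
  shows "pnorm p \<eta> \<le> 2 powr (1 / p) * max \<bar>\<eta> $ 1\<bar> \<bar>\<eta> $ 2\<bar>"
proof -
  define m where "m = max \<bar>\<eta> $ 1\<bar> \<bar>\<eta> $ 2\<bar>"
  have "\<bar>\<eta> $ 1\<bar> powr p \<le> m powr p" "\<bar>\<eta> $ 2\<bar> powr p \<le> m powr p"
    using assms by (auto simp: m_def intro!: powr_mono2)
  then have "pnorm p \<eta> \<le> (2 * m powr p) powr (1 / p)"
    unfolding pnorm_def using assms by (intro powr_mono2) auto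
  also have "\<dots> = 2 powr (1 / p) * m"
    using assms by (simp add: powr_mult powr_powr m_def)
  finally show ?thesis by (simp add: m_def)
qed

text \<open>The map \<open>x\<close> raises the coordinates divided by \<open>N\<close> to the power
  \<open>p / 2\<close> with their signs kept. This lands on the unit circle, whose angle is \<phi>,
  and the power \<open>2 / p\<close> undoes it. Hence uniformity in \<phi> amounts to a bound over
  all \<eta>.\<close>

lemma ppolar_pnorm_surj:
  fixes \<eta> :: "real ^ 2"
  assumes p: "p > 0"
  shows "\<exists>\<phi>\<in>{0..<2 * pi}. \<eta> = ppolar p (pnorm p \<eta>) \<phi>"
proof (cases "\<eta> = 0")
  case True
  then show ?thesis
    by (intro bexI[of _ 0]) (auto simp: ppolar_def pnorm_def vec_eq_iff forall_2)
next
  case False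
  define N where "N = pnorm p \<eta>"
  define S where "S = \<bar>\<eta> $ 1\<bar> powr p + \<bar>\<eta> $ 2\<bar> powr p"
  have "\<eta> $ 1 \<noteq> 0 \<or> \<eta> $ 2 \<noteq> 0" using False by (auto simp: vec_eq_iff forall_2)
  then have S: "S > 0" by (auto simp: S_def intro: add_pos_nonneg add_nonneg_pos)
  have N: "N > 0" "N powr p = S" using S p by (auto simp: N_def pnorm_def S_def[symmetric] powr_powr)
  define x where "x = (\<lambda>u. sgn u * (\<bar>u\<bar> / N) powr (p / 2))"
  have x2: "(x u)\<^sup>2 = \<bar>u\<bar> powr p / S" for u
  proof -
    have "(x u)\<^sup>2 = (\<bar>u\<bar> / N) powr (p / 2) * (\<bar>u\<bar> / N) powr (p / 2)"
      by (simp add: x_def power2_eq_square sgn_if)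
    also have "\<dots> = (\<bar>u\<bar> / N) powr p" by (simp flip: powr_add)
    finally show ?thesis using N by (simp add: powr_divide)
  qed
  have recover: "u = sgn (x u) * N * \<bar>x u\<bar> powr (2 / p)" for u
    using N p by (auto simp: x_def abs_mult powr_powr sgn_mult sgn_if)
  have "(x (\<eta> $ 1))\<^sup>2 + (x (\<eta> $ 2))\<^sup>2 = 1"
    unfolding x2 add_divide_distrib[symmetric] using S by (simp add: S_def)
  then obtain \<phi> where \<phi>: "0 \<le> \<phi>" "\<phi> < 2 * pi" "x (\<eta> $ 1) = cos \<phi>" "x (\<eta> $ 2) = sin \<phi>"
    by (rule sincos_total_2pi)
  have "\<eta> = ppolar p N \<phi>"
    unfolding vec_eq_iff forall_2 ppolar_def using recover[of "\<eta> $ 1"] recover[of "\<eta> $ 2"] \<phi> by simp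
  then show ?thesis using \<phi> by (auto simp: N_def)
qed

section \<open>Decay of the generalised Bessel function\<close>

text \<open>Both ranges of \<open>p\<close>, which are \<open>q = 1 / 2\<close> and
  \<open>q > 1\<close>, get the exponent -1/2, because the integral bound decays like the inverse
  square root of the larger coordinate, which is comparable to the p-norm.\<close>

lemma gen_bessel0_decay:
  assumes "p = 2 \<or> 0 < p \<and> p < 1"
  obtains C where "C > 0"
    "\<And>\<eta>. pnorm p \<eta> \<ge> 2 powr (1 / p) \<Longrightarrow> \<bar>gen_bessel0 p \<eta>\<bar> \<le> C * pnorm p \<eta> powr (- 1 / 2)"
proof -
  have p: "p > 0" using assms by auto
  define q where "q = 1 / p"
  have q: "q = 1 / 2 \<or> q > 1" using assms by (auto simp: q_def)
  then have q0: "q > 0" by auto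
  define B where "B = 2 * ((1 + pi) / q + pi * (4 + 1 / \<bar>q - 1\<bar>) + 4 * Beta q q)"
  define c where "c = 1 / (Gamma q)\<^sup>2 * (2 / p)\<^sup>2"
  have "Beta q q > 0" using q0 by (simp add: Beta_def Gamma_real_pos)
  moreover have "(1 + pi) / q > 0" using q0 pi_gt_zero by (intro divide_pos_pos) linarith+
  ultimately have B: "B > 0" unfolding B_def by (intro mult_pos_pos add_pos_nonneg) auto
  have c: "c > 0" unfolding c_def
    using p q0 Gamma_real_pos[of q] by (intro mult_pos_pos divide_pos_pos zero_less_power) auto
  show ?thesis
  \<comment> \<open>\<open>c\<close> is the prefactor of the Bessel function, \<open>B\<close> the
    oscillatory constant; the last factor pays for replacing the maximum of the coordinates by the
    p-norm.\<close>
  proof (rule that[of "c * B * (2 powr q) powr (1 / 2)"])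
    show "c * B * (2 powr q) powr (1 / 2) > 0" using B c by simp
    fix \<eta> assume N: "pnorm p \<eta> \<ge> 2 powr (1 / p)"
    define m where "m = max \<bar>\<eta> $ 1\<bar> \<bar>\<eta> $ 2\<bar>"
    have m: "pnorm p \<eta> \<le> 2 powr q * m" using pnorm_le_max[OF p] by (simp add: m_def q_def)
    \<comment> \<open>The threshold on the p-norm is chosen so that the larger coordinate is at
      least 1.\<close>
    have "2 powr q * 1 \<le> 2 powr q * m" using order_trans[OF N m] by (simp add: q_def)
    then have m1: "1 \<le> m" by (rule mult_left_le_imp_le) simp
    have "\<bar>gen_bessel0 p \<eta>\<bar> \<le> c * (B / sqrt m)"
      unfolding gen_bessel0_def q_def[symmetric] c_def[symmetric] abs_mult[of c]
      unfolding abs_of_pos[OF c] m_def B_def using m1 c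
      by (intro mult_left_mono gen_bessel0_integral_bound q) (simp_all add: m_def)
    also have "B / sqrt m = B * (2 powr q) powr (1 / 2) * (2 powr q * m) powr (- 1 / 2)"
      using m1 by (simp add: powr_mult powr_minus_divide powr_half_sqrt)
    also have "\<dots> \<le> B * (2 powr q) powr (1 / 2) * pnorm p \<eta> powr (- 1 / 2)"
      using m B N by (intro mult_left_mono powr_mono2') (auto intro: less_le_trans[OF _ N])
    finally show "\<bar>gen_bessel0 p \<eta>\<bar> \<le> c * B * (2 powr q) powr (1 / 2) * pnorm p \<eta> powr (- 1 / 2)"
      using c by (simp add: mult.assoc mult_left_mono)
  qed
qed

theorem theorem1p5:
  fixes p :: real
  assumes "p > 0" and "2 / p \<in> \<nat>" and "2 / p \<noteq> 2"
  shows "(\<forall>\<eta>. \<exists>\<phi>\<in>{0..<2 * pi}. \<eta> = ppolar p (pnorm p \<eta>) \<phi>) \<and>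
    (\<exists>C>0. \<exists>R>0. \<forall>\<eta>. pnorm p \<eta> \<ge> R \<longrightarrow>
         (p = 2 \<longrightarrow> \<bar>gen_bessel0 p \<eta>\<bar> \<le> C * pnorm p \<eta> powr (- 1 / 2)) \<and>
         (2 / p \<in> \<nat> - {1, 2} \<longrightarrow> \<bar>gen_bessel0 p \<eta>\<bar> \<le> C * pnorm p \<eta> powr (- p / 2)))"
proof (rule conjI)
  show "\<forall>\<eta>. \<exists>\<phi>\<in>{0..<2 * pi}. \<eta> = ppolar p (pnorm p \<eta>) \<phi>"
    using ppolar_pnorm_surj[OF assms(1)] by blast
  obtain n where n: "2 / p = real n" using assms(2) by (auto elim: Nats_cases)
  have "real n > 0" using n assms(1) by (metis divide_pos_pos zero_less_numeral)
  then have p: "p = 2 / real n" "n > 0" using n assms(1) by (auto simp: field_simps)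
  have "n \<noteq> 2" using n assms(3) by auto
  \<comment> \<open>The value \<open>n = 1\<close> gives \<open>p = 2\<close>, and
    \<open>n \<ge> 3\<close> gives \<open>p \<le> 2 / 3\<close>. For the excluded
    \<open>n = 2\<close>, that is \<open>q = 1\<close>, the factor \<open>D\<close> is constant and
    vanishes identically for \<open>a = b\<close> and \<sigma> = 1, which leaves no
    oscillation.\<close>
  then have "n = 1 \<or> n \<ge> 3" using p(2) by auto
  then have *: "p = 2 \<or> 0 < p \<and> p < 1" using p by auto
  obtain C where C: "C > 0" 
    "\<And>\<eta>. pnorm p \<eta> \<ge> 2 powr (1 / p) \<Longrightarrow> \<bar>gen_bessel0 p \<eta>\<bar> \<le> C * pnorm p \<eta> powr (- 1 / 2)"
    using gen_bessel0_decay[OF *] by blast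
  have "\<bar>gen_bessel0 p \<eta>\<bar> \<le> C * pnorm p \<eta> powr (- p / 2)"
    if N: "pnorm p \<eta> \<ge> 2 powr (1 / p)" and "p < 1" for \<eta>
  proof -
    \<comment> \<open>With base at least 1 and \<open>p < 1\<close>, the larger exponent
      \<open>- p / 2\<close> gives the larger power.\<close>
    have "pnorm p \<eta> \<ge> 1" using N assms(1) ge_one_powr_ge_zero[of 2 "1 / p"] by simp
    then have "pnorm p \<eta> powr (- 1 / 2) \<le> pnorm p \<eta> powr (- p / 2)"
      using \<open>p < 1\<close> by (intro powr_mono) auto
    then show ?thesis using C(2)[OF N] C(1) by (meson mult_left_mono order_trans less_imp_le)
  qed
  moreover have "p < 1" if "2 / p \<in> \<nat> - {1, 2}" using * that by auto
  ultimately show "\<exists>C>0. \<exists>R>0. \<forall>\<eta>. pnorm p \<eta> \<ge> R \<longrightarrow>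
         (p = 2 \<longrightarrow> \<bar>gen_bessel0 p \<eta>\<bar> \<le> C * pnorm p \<eta> powr (- 1 / 2)) \<and>
         (2 / p \<in> \<nat> - {1, 2} \<longrightarrow> \<bar>gen_bessel0 p \<eta>\<bar> \<le> C * pnorm p \<eta> powr (- p / 2))"
    using C by (intro exI[of _ C] conjI exI[of _ "2 powr (1 / p)"] allI impI) simp_all
qed

end
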